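(* Let $G$ be a graph with $n$ vertices and let $k\geq 1$ be an integer with $n\geq k+1$. Let $H_1,\dots,H_m$ ($m\geq 1$) be pairwise vertex-disjoint induced subgraphs of $G$. Then for all integers $s_1,\dots,s_m$ such that $1\leq s_i\leq |V(H_i)|$ for each $i$ and $\sum_{i=1}^m s_i=k$, the graph $F_{s_1}(H_1)\,\square\,\cdots\,\square\,F_{s_m}(H_m)$ is (isomorphic to) an induced subgraph of $F_k(G)$.
   Context: Graphs are finite, simple and undirected. For a graph $G$ and an integer $k\geq 1$, the $k$-token graph $F_k(G)$ is the graph whose vertices are the $k$-element subsets of $V(G)$, where two vertices $A,B$ are adjacent whenever their symmetric difference $A\triangle B$ is a pair $\{a,b\}$ with $a\in A$, $b\in B$ and $ab\in E(G)$. (When $k=|V(G)|$ this is a single vertex.) The Cartesian product $G\,\square\,H$ has vertex set $V(G)\times V(H)$, where $(g,h)$ and $(g',h')$ are adjacent whenever $g=g'$ and $hh'\in E(H)$, or $h=h'$ and $gg'\in E(G)$. For $m\geq 3$ graphs the product is defined recursively as $G_1\,\square\,(G_2\,\square\,\cdots\,\square\,G_m)$; for $m=1$ it is the graph itself. *)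

theory Defs
  imports "Graph_Theory.Digraph_Isomorphism"
begin

text \<open>
  Finite simple undirected graphs are represented by the locale \<^locale>\<open>pair_graph\<close>: finite
  vertex set, symmetric and loop-free arc relation. An edge \<open>ab\<close> is the pair of arcs
  \<open>(a,b)\<close>, \<open>(b,a)\<close>.
\<close>

definition token_graph :: "nat \<Rightarrow> 'a pair_pre_digraph \<Rightarrow> 'a set pair_pre_digraph" where
  "token_graph k G =
     \<lparr> pverts = {A. A \<subseteq> pverts G \<and> card A = k},
       parcs = {(A, B). A \<subseteq> pverts G \<and> card A = k \<and> B \<subseteq> pverts G \<and> card B = k \<and>
         (\<exists>a\<in>A. \<exists>b\<in>B. (A - B) \<union> (B - A) = {a, b} \<and> (a, b) \<in> parcs G)} \<rparr>"

definition cart_prod ::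
    "'a pair_pre_digraph \<Rightarrow> 'b pair_pre_digraph \<Rightarrow> ('a \<times> 'b) pair_pre_digraph" where
  "cart_prod G H =
     \<lparr> pverts = pverts G \<times> pverts H,
       parcs = {((g, h), (g', h')).
         (g = g' \<and> g \<in> pverts G \<and> (h, h') \<in> parcs H) \<or>
         (h = h' \<and> h \<in> pverts H \<and> (g, g') \<in> parcs G)} \<rparr>"

definition relabel :: "('a \<Rightarrow> 'b) \<Rightarrow> 'a pair_pre_digraph \<Rightarrow> 'b pair_pre_digraph" where
  "relabel f G = \<lparr> pverts = f ` pverts G, parcs = map_prod f f ` parcs G \<rparr>"

text \<open>
  The vertex type of the iterated product \<open>G\<^sub>1 \<box> (G\<^sub>2 \<box> \<dots> \<box> G\<^sub>m)\<close> would depend on \<open>m\<close>. The nested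
  tuple \<open>(v\<^sub>1, (v\<^sub>2, \<dots>, v\<^sub>m))\<close> is therefore encoded as the list \<open>[v\<^sub>1, v\<^sub>2, \<dots>, v\<^sub>m]\<close>; both relabellings
  below are injective. The empty product is a dummy value.
\<close>

fun cart_prods :: "'a pair_pre_digraph list \<Rightarrow> 'a list pair_pre_digraph" where
  "cart_prods [] = \<lparr> pverts = {[]}, parcs = {} \<rparr>"
| "cart_prods [G] = relabel (\<lambda>v. [v]) G"
| "cart_prods (G # H # Gs) =
     relabel (\<lambda>(v, vs). v # vs) (cart_prod G (cart_prods (H # Gs)))"

lemma pair_graphI:
  assumes "finite (pverts G)"
    and "\<And>u v. (u, v) \<in> parcs G \<Longrightarrow> u \<in> pverts G \<and> v \<in> pverts G \<and> u \<noteq> v \<and> (v, u) \<in> parcs G"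
  shows "pair_graph G"
proof -
  have "parcs G \<subseteq> pverts G \<times> pverts G"
    using assms(2) by auto
  then have "finite (parcs G)"
    using assms(1) finite_subset by blast
  then show ?thesis
    using assms by unfold_locales (auto simp: symmetric_def sym_def)
qed

lemma pair_graphD:
  assumes "pair_graph G" "(u, v) \<in> parcs G"
  shows "u \<in> pverts G" "v \<in> pverts G" "u \<noteq> v" "(v, u) \<in> parcs G"
proof -
  interpret pair_graph G by fact
  show "u \<in> pverts G" "v \<in> pverts G" "u \<noteq> v" "(v, u) \<in> parcs G"
    using assms(2) in_arcsD1 in_arcsD2 no_loops' pair_sym_arcs
    by (auto simp: symmetric_def dest: symD)
qed

lemma pair_graph_finite: "pair_graph G \<Longrightarrow> finite (pverts G)"
  by (simp add: pair_graph.axioms(1) pair_digraph.axioms(1) pair_fin_digraph.pair_finite_verts)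

lemma pair_graph_token_graph:
  assumes "pair_graph G"
  shows "pair_graph (token_graph k G)"
proof (rule pair_graphI)
  show "finite (pverts (token_graph k G))"
    using pair_graph_finite[OF assms] by (auto simp: token_graph_def)
next
  fix A B assume "(A, B) \<in> parcs (token_graph k G)"
  then obtain a b where *: "A \<subseteq> pverts G" "card A = k" "B \<subseteq> pverts G" "card B = k"
      "a \<in> A" "b \<in> B" "(A - B) \<union> (B - A) = {a, b}" "(a, b) \<in> parcs G"
    by (auto simp: token_graph_def)
  moreover have "(B - A) \<union> (A - B) = {b, a}" "(b, a) \<in> parcs G"
    using *(7) pair_graphD(4)[OF assms *(8)] by (simp_all add: Un_commute insert_commute)
  moreover have "A \<noteq> B"
    using *(7) by auto
  ultimately show "A \<in> pverts (token_graph k G) \<and> B \<in> pverts (token_graph k G) \<and> A \<noteq> B \<and>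
      (B, A) \<in> parcs (token_graph k G)"
    unfolding token_graph_def by simp blast
qed

lemma pair_graph_cart_prod:
  assumes "pair_graph G" "pair_graph H"
  shows "pair_graph (cart_prod G H)"
proof (rule pair_graphI)
  show "finite (pverts (cart_prod G H))"
    using assms by (simp add: cart_prod_def pair_graph_finite)
next
  fix x y assume "(x, y) \<in> parcs (cart_prod G H)"
  moreover obtain g h g' h' where "x = (g, h)" "y = (g', h')"
    by fastforce
  ultimately consider "x = (g, h)" "y = (g, h')" "g \<in> pverts G" "(h, h') \<in> parcs H"
    | "x = (g, h)" "y = (g', h)" "h \<in> pverts H" "(g, g') \<in> parcs G"
    by (auto simp: cart_prod_def)
  then show "x \<in> pverts (cart_prod G H) \<and> y \<in> pverts (cart_prod G H) \<and> x \<noteq> y \<and>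
      (y, x) \<in> parcs (cart_prod G H)"
  proof cases
    case 1
    with pair_graphD[OF assms(2) 1(4)] show ?thesis by (simp add: cart_prod_def)
  next
    case 2
    with pair_graphD[OF assms(1) 2(4)] show ?thesis by (simp add: cart_prod_def)
  qed
qed

lemma pair_graph_relabel:
  assumes "pair_graph G" "inj f"
  shows "pair_graph (relabel f G)"
proof (rule pair_graphI)
  show "finite (pverts (relabel f G))"
    using assms by (simp add: relabel_def pair_graph_finite)
next
  fix x y assume "(x, y) \<in> parcs (relabel f G)"
  then obtain u v where *: "x = f u" "y = f v" "(u, v) \<in> parcs G"
    by (auto simp: relabel_def)
  note pair_graphD[OF assms(1) *(3)]
  then show "x \<in> pverts (relabel f G) \<and> y \<in> pverts (relabel f G) \<and> x \<noteq> y \<and>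
      (y, x) \<in> parcs (relabel f G)"
    using *(1,2) assms(2) by (simp add: relabel_def inj_eq rev_image_eqI[of "(v, u)"])
qed

lemma pair_graph_cart_prods:
  assumes "\<And>G. G \<in> set Gs \<Longrightarrow> pair_graph G"
  shows "pair_graph (cart_prods Gs)"
  using assms
proof (induction Gs rule: cart_prods.induct)
  case 1
  show ?case by (rule pair_graphI) auto
next
  case (2 G)
  then show ?case by (auto intro!: pair_graph_relabel injI)
next
  case (3 G H Gs)
  then show ?case by (auto intro!: pair_graph_relabel pair_graph_cart_prod injI)
qed

end

theory Submission
  imports Defs
begin

text \<open>
  The embedding sends \<open>(A\<^sub>1, \<dots>, A\<^sub>m)\<close> to \<open>A\<^sub>1 \<union> \<dots> \<union> A\<^sub>m\<close>. For two factors on disjoint sets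
  \<open>V, W\<close>, the union recovers its parts by intersection, and the differences of two unions split
  over \<open>V\<close> and \<open>W\<close>. A token cannot move from \<open>V\<close> to \<open>W\<close>, since the number of tokens in each
  part is fixed, so a single move in the union is a single move in exactly one of the factors.
  The general case is an induction on \<open>m\<close>.
\<close>

definition induced_on :: "'a pair_pre_digraph \<Rightarrow> 'a set \<Rightarrow> 'a pair_pre_digraph" where
  "induced_on G W = \<lparr> pverts = W, parcs = parcs G \<inter> W \<times> W \<rparr>"

lemma induced_on_simps [simp]:
  "pverts (induced_on G W) = W"
  "parcs (induced_on G W) = parcs G \<inter> W \<times> W"
  by (simp_all add: induced_on_def)

lemma induced_subgraph_imp_induced_on:
  assumes "induced_subgraph (with_proj H) (with_proj G)"
  shows "H = induced_on G (pverts H)" "pverts H \<subseteq> pverts G"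
  using assms
  by (auto simp: induced_subgraph_def subgraph_def induced_on_def intro!: pair_pre_digraph.equality)

lemma induced_subgraph_induced_on:
  assumes "pair_wf_digraph G" "W \<subseteq> pverts G"
  shows "induced_subgraph (with_proj (induced_on G W)) (with_proj G)"
proof -
  have "pair_wf_digraph (induced_on G W)"
    by unfold_locales auto
  with assms show ?thesis
    by (auto simp: induced_subgraph_def subgraph_def wf_digraph_wp_iff)
qed

definition embeds :: "('a \<Rightarrow> 'b) \<Rightarrow> 'a pair_pre_digraph \<Rightarrow> 'b pair_pre_digraph \<Rightarrow> bool" where
  "embeds f G K \<longleftrightarrow> f ` pverts G \<subseteq> pverts K \<and> inj_on f (pverts G) \<and>
     (\<forall>u\<in>pverts G. \<forall>v\<in>pverts G. (f u, f v) \<in> parcs K \<longleftrightarrow> (u, v) \<in> parcs G)"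

lemma embeds_comp:
  assumes "embeds f G K" "embeds g K L"
  shows "embeds (g \<circ> f) G L"
proof -
  have "inj_on (g \<circ> f) (pverts G)"
    using assms unfolding embeds_def by (blast intro: comp_inj_on inj_on_subset)
  with assms show ?thesis
    unfolding embeds_def by (simp add: image_subset_iff)
qed

lemma embeds_relabel:
  assumes "embeds f G K" "inj g"
  shows "embeds (f \<circ> inv g) (relabel g G) K"
proof -
  have "(map_prod g g (u, v) \<in> map_prod g g ` parcs G) \<longleftrightarrow> (u, v) \<in> parcs G" for u v
    using assms(2) by (intro inj_image_mem_iff prod.inj_map)
  then show ?thesis
    using assms unfolding embeds_def relabel_def
    by (auto simp: inv_f_f intro!: inj_onI dest: inj_onD)
qed

lemma embeds_cart_prod:
  assumes "embeds f G G'" "embeds g H H'"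
  shows "embeds (map_prod f g) (cart_prod G H) (cart_prod G' H')"
proof -
  have f: "f u \<in> pverts G'" "f u = f v \<longleftrightarrow> u = v" "(f u, f v) \<in> parcs G' \<longleftrightarrow> (u, v) \<in> parcs G"
    if "u \<in> pverts G" "v \<in> pverts G" for u v
    using assms(1) that by (auto simp: embeds_def inj_on_eq_iff)
  have g: "g u \<in> pverts H'" "g u = g v \<longleftrightarrow> u = v" "(g u, g v) \<in> parcs H' \<longleftrightarrow> (u, v) \<in> parcs H"
    if "u \<in> pverts H" "v \<in> pverts H" for u v
    using assms(2) that by (auto simp: embeds_def inj_on_eq_iff)
  have "inj_on (map_prod f g) (pverts G \<times> pverts H)"
    using assms by (intro map_prod_inj_on) (auto simp: embeds_def)
  then show ?thesis
    unfolding embeds_def cart_prod_def by (simp add: image_subset_iff f g)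
qed

lemma embeds_imp_iso_induced_subgraph:
  assumes "embeds f G K" "pair_graph G" "pair_graph K"
  shows "\<exists>S. induced_subgraph (with_proj S) (with_proj K) \<and>
    digraph_iso (with_proj G) (with_proj S)"
proof (intro exI conjI)
  interpret G: pair_graph G by fact
  interpret K: pair_graph K by fact
  let ?S = "induced_on K (f ` pverts G)"
  let ?f = "\<lparr>iso_verts = f, iso_arcs = map_prod f f, iso_head = snd, iso_tail = fst\<rparr>"
  show "induced_subgraph (with_proj ?S) (with_proj K)"
    using assms(1) K.pair_wf_digraph_axioms
    by (intro induced_subgraph_induced_on) (auto simp: embeds_def)
  have arcs: "parcs G \<subseteq> pverts G \<times> pverts G"
    by (auto dest: G.in_arcsD1 G.in_arcsD2)
  have inj: "inj_on f (pverts G)"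
    using assms(1) by (simp add: embeds_def)
  have "inj_on (map_prod f f) (parcs G)"
    using map_prod_inj_on[OF inj inj] arcs by (rule inj_on_subset)
  then have "pre_digraph.digraph_isomorphism (with_proj G) ?f"
    using inj G.pair_wf_digraph_axioms
    by (simp add: pre_digraph.digraph_isomorphism_def wf_digraph_wp_iff)
  moreover have "map_prod f f ` parcs G = parcs ?S"
  proof (intro equalityI subrelI)
    fix x y assume "(x, y) \<in> map_prod f f ` parcs G"
    then obtain u v where "x = f u" "y = f v" "(u, v) \<in> parcs G"
      by auto
    with assms(1) arcs show "(x, y) \<in> parcs ?S"
      by (auto simp: embeds_def)
  next
    fix x y assume "(x, y) \<in> parcs ?S"
    then obtain u v where *: "x = f u" "y = f v" "u \<in> pverts G" "v \<in> pverts G"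
        "(f u, f v) \<in> parcs K"
      by auto
    with assms(1) have "(u, v) \<in> parcs G"
      by (simp add: embeds_def)
    from imageI[OF this, of "map_prod f f"] show "(x, y) \<in> map_prod f f ` parcs G"
      using * by simp
  qed
  then have "with_proj ?S = app_iso ?f (with_proj G)"
    by (simp add: with_proj_def app_iso_def)
  ultimately show "digraph_iso (with_proj G) (with_proj ?S)"
    unfolding digraph_iso_def by blast
qed

lemma pverts_token_graph [simp]:
  "pverts (token_graph k G) = {A. A \<subseteq> pverts G \<and> card A = k}"
  by (simp add: token_graph_def)

lemma parcs_token_graph_iff:
  "(A, B) \<in> parcs (token_graph k G) \<longleftrightarrow>
     A \<in> pverts (token_graph k G) \<and> B \<in> pverts (token_graph k G) \<and>
     (\<exists>a b. A - B = {a} \<and> B - A = {b} \<and> (a, b) \<in> parcs G)"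
proof -
  have "(a \<in> A \<and> b \<in> B \<and> (A - B) \<union> (B - A) = {a, b}) \<longleftrightarrow> A - B = {a} \<and> B - A = {b}" for a b
    by blast
  then show ?thesis
    unfolding token_graph_def by auto blast+
qed

lemma parcs_token_graph_induced_on_iff:
  "(A, B) \<in> parcs (token_graph k (induced_on G W)) \<longleftrightarrow>
     A \<in> pverts (token_graph k (induced_on G W)) \<and>
     B \<in> pverts (token_graph k (induced_on G W)) \<and>
     (\<exists>a b. A - B = {a} \<and> B - A = {b} \<and> (a, b) \<in> parcs G)"
proof -
  have "a \<in> W \<and> b \<in> W" if "A \<subseteq> W" "B \<subseteq> W" "A - B = {a}" "B - A = {b}" for a b
    using that by blast
  then show ?thesis
    unfolding parcs_token_graph_iff by (simp del: ex_simps) blast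
qed

lemma embeds_token_graph_induced_on:
  assumes "W \<subseteq> pverts G"
  shows "embeds id (token_graph k (induced_on G W)) (token_graph k G)"
  using assms
  unfolding embeds_def parcs_token_graph_induced_on_iff
  by (auto simp: parcs_token_graph_iff[of _ _ k G])

lemma embeds_cart_prod_token_graph:
  assumes "finite V" "finite W" "V \<inter> W = {}"
  shows "embeds (\<lambda>(X, Y). X \<union> Y)
    (cart_prod (token_graph s (induced_on G V)) (token_graph t (induced_on G W)))
    (token_graph (s + t) (induced_on G (V \<union> W)))"
    (is "embeds ?f ?P ?T")
  unfolding embeds_def
proof (intro conjI ballI)
  have fin: "finite X" if "X \<subseteq> V \<or> X \<subseteq> W" for X
    using assms that finite_subset by blast
  have verts: "(X, Y) \<in> pverts ?P \<longleftrightarrow> X \<subseteq> V \<and> card X = s \<and> Y \<subseteq> W \<and> card Y = t" for X Y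
    by (auto simp: cart_prod_def)
  have union: "X \<union> Y \<in> pverts ?T" if "(X, Y) \<in> pverts ?P" for X Y
  proof -
    have "card (X \<union> Y) = card X + card Y"
      using that assms unfolding verts by (intro card_Un_disjoint fin) auto
    then show ?thesis
      using that unfolding verts by auto
  qed
  then show "?f ` pverts ?P \<subseteq> pverts ?T"
    by (auto simp del: pverts_token_graph)
  have parts: "X = (X \<union> Y) \<inter> V" "Y = (X \<union> Y) \<inter> W" if "X \<subseteq> V" "Y \<subseteq> W" for X Y
    using that assms(3) by auto
  show "inj_on ?f (pverts ?P)"
  proof (rule inj_onI, clarify)
    fix X Y X' Y'
    assume "(X, Y) \<in> pverts ?P" "(X', Y') \<in> pverts ?P" "X \<union> Y = X' \<union> Y'"
    with parts[of X Y] parts[of X' Y'] show "X = X' \<and> Y = Y'"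
      unfolding verts by argo
  qed
  fix p q
  assume p: "p \<in> pverts ?P" and q: "q \<in> pverts ?P"
  obtain X Y X' Y' where pq: "p = (X, Y)" "q = (X', Y')"
    by fastforce
  have X: "X \<subseteq> V" "X' \<subseteq> V" "card X = s" "card X' = s"
    and Y: "Y \<subseteq> W" "Y' \<subseteq> W" "card Y = t" "card Y' = t"
    using p q unfolding pq verts by auto
  have empty: "A - B = {} \<longleftrightarrow> B - A = {}" if "finite A" "finite B" "card A = card B" for A B :: "'a set"
    using that card_subset_eq[of A B] card_subset_eq[of B A] by auto
  have emptyX: "X - X' = {} \<longleftrightarrow> X' - X = {}" and emptyY: "Y - Y' = {} \<longleftrightarrow> Y' - Y = {}"
    using X Y by (intro empty fin; simp)+
  have diff: "(X \<union> Y) - (X' \<union> Y') = (X - X') \<union> (Y - Y')"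
    "(X' \<union> Y') - (X \<union> Y) = (X' - X) \<union> (Y' - Y)"
    using X Y assms(3) by auto
  have disj: "(X - X') \<inter> (Y - Y') = {}"
    using X Y assms(3) by auto
  have arc: "(?f p, ?f q) \<in> parcs ?T \<longleftrightarrow> (\<exists>a b. (X - X') \<union> (Y - Y') = {a} \<and>
      (X' - X) \<union> (Y' - Y) = {b} \<and> (a, b) \<in> parcs G)"
    using union[of X Y] union[of X' Y'] p q
    unfolding pq parcs_token_graph_induced_on_iff prod.case diff by blast
  have arcP: "(p, q) \<in> parcs ?P \<longleftrightarrow>
      (X = X' \<and> (\<exists>a b. Y - Y' = {a} \<and> Y' - Y = {b} \<and> (a, b) \<in> parcs G)) \<or>
      (Y = Y' \<and> (\<exists>a b. X - X' = {a} \<and> X' - X = {b} \<and> (a, b) \<in> parcs G))"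
    using X Y unfolding pq cart_prod_def by (auto simp: parcs_token_graph_induced_on_iff)
  show "(?f p, ?f q) \<in> parcs ?T \<longleftrightarrow> (p, q) \<in> parcs ?P"
  proof
    assume "(?f p, ?f q) \<in> parcs ?T"
    then obtain a b where ab: "(X - X') \<union> (Y - Y') = {a}" "(X' - X) \<union> (Y' - Y) = {b}"
        "(a, b) \<in> parcs G"
      unfolding arc by blast
    then consider "X - X' = {}" "Y - Y' = {a}" | "X - X' = {a}" "Y - Y' = {}"
      using disj by (auto simp: Un_singleton_iff)
    then show "(p, q) \<in> parcs ?P"
    proof cases
      case 1
      with emptyX ab(2) have "X = X'" "Y' - Y = {b}" by auto
      with 1 ab(3) show ?thesis unfolding arcP by blast
    next
      case 2
      with emptyY ab(2) have "Y = Y'" "X' - X = {b}" by auto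
      with 2 ab(3) show ?thesis unfolding arcP by blast
    qed
  next
    assume "(p, q) \<in> parcs ?P"
    then consider a b where "X = X'" "Y - Y' = {a}" "Y' - Y = {b}" "(a, b) \<in> parcs G"
      | a b where "Y = Y'" "X - X' = {a}" "X' - X = {b}" "(a, b) \<in> parcs G"
      unfolding arcP by blast
    then show "(?f p, ?f q) \<in> parcs ?T"
      unfolding arc by cases auto
  qed
qed

lemma embeds_cart_prods_token_graph:
  assumes "is \<noteq> []" "distinct is" "disjoint_family_on W (set is)" "\<And>i. i \<in> set is \<Longrightarrow> finite (W i)"
  shows "\<exists>f. embeds f (cart_prods (map (\<lambda>i. token_graph (s i) (induced_on G (W i))) is))
    (token_graph (\<Sum>i\<leftarrow>is. s i) (induced_on G (\<Union>i\<in>set is. W i)))"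
  using assms
proof (induction "is" rule: induct_list012)
  case (2 i)
  have "embeds id (token_graph (s i) (induced_on G (W i))) (token_graph (s i) (induced_on G (W i)))"
    by (simp add: embeds_def)
  from embeds_relabel[OF this, of "\<lambda>v. [v]"] show ?case
    by (auto simp: inj_def)
next
  case (3 i j "is")
  let ?V = "\<Union>i\<in>set (j # is). W i" and ?t = "\<Sum>i\<leftarrow>j # is. s i"
  let ?A = "token_graph (s i) (induced_on G (W i))" and ?T = "token_graph ?t (induced_on G ?V)"
  let ?C = "cart_prods (map (\<lambda>i. token_graph (s i) (induced_on G (W i))) (j # is))"
  have "disjoint_family_on W (set (j # is))"
    using "3.prems"(3) by (rule disjoint_family_on_mono[rotated]) auto
  with "3.IH"(2) "3.prems" obtain f where f: "embeds f ?C ?T"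
    by auto
  have "embeds id ?A ?A"
    by (simp add: embeds_def)
  from embeds_cart_prod[OF this f]
  have "embeds (map_prod id f) (cart_prod ?A ?C) (cart_prod ?A ?T)" .
  moreover have "W i \<inter> ?V = {}"
    using "3.prems"(2,3) unfolding disjoint_family_on_def by fastforce
  then have "embeds (\<lambda>(X, Y). X \<union> Y) (cart_prod ?A ?T)
      (token_graph (s i + ?t) (induced_on G (W i \<union> ?V)))"
    using "3.prems"(4) by (intro embeds_cart_prod_token_graph) auto
  ultimately have "embeds ((\<lambda>(X, Y). X \<union> Y) \<circ> map_prod id f) (cart_prod ?A ?C)
      (token_graph (s i + ?t) (induced_on G (W i \<union> ?V)))"
    by (rule embeds_comp)
  from embeds_relabel[OF this, of "\<lambda>(v, vs). v # vs"] show ?case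
    by (auto simp: inj_def)
qed simp

theorem theorem16:
  fixes G :: "'a pair_pre_digraph"
    and H :: "nat \<Rightarrow> 'a pair_pre_digraph"
    and s :: "nat \<Rightarrow> nat"
    and n k m :: nat
  assumes "pair_graph G"
    and "card (pverts G) = n"
    and "k \<ge> 1"
    and "n \<ge> k + 1"
    and "m \<ge> 1"
    and "\<And>i. i \<in> {1..m} \<Longrightarrow> induced_subgraph (with_proj (H i)) (with_proj G)"
    and "\<And>i j. i \<in> {1..m} \<Longrightarrow> j \<in> {1..m} \<Longrightarrow> i \<noteq> j \<Longrightarrow> pverts (H i) \<inter> pverts (H j) = {}"
    and "\<And>i. i \<in> {1..m} \<Longrightarrow> 1 \<le> s i \<and> s i \<le> card (pverts (H i))"
    and "(\<Sum>i=1..m. s i) = k"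
  shows "\<exists>S. induced_subgraph (with_proj S) (with_proj (token_graph k G)) \<and>
    digraph_iso (with_proj (cart_prods (map (\<lambda>i. token_graph (s i) (H i)) [1..<Suc m])))
      (with_proj S)"
proof -
  define W where "W i = pverts (H i)" for i
  define T where "T i = token_graph (s i) (H i)" for i
  let ?is = "[1..<Suc m]"
  have set_is: "set ?is = {1..m}"
    by auto
  have H: "H i = induced_on G (W i)" "W i \<subseteq> pverts G" if "i \<in> {1..m}" for i
    using induced_subgraph_imp_induced_on[OF assms(6)[OF that]] by (simp_all add: W_def)
  have fin: "finite (W i)" if "i \<in> {1..m}" for i
    using H(2)[OF that] pair_graph_finite[OF assms(1)] finite_subset by blast
  have disj: "disjoint_family_on W {1..m}"
    using assms(7) by (simp add: disjoint_family_on_def W_def)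
  have sum: "(\<Sum>i\<leftarrow>?is. s i) = k"
    using assms(9) by (simp only: interv_sum_list_conv_sum_set_nat set_is)
  have "map T ?is = map (\<lambda>i. token_graph (s i) (induced_on G (W i))) ?is"
    using H(1) unfolding T_def by (intro map_cong) auto
  moreover obtain f where "embeds f
      (cart_prods (map (\<lambda>i. token_graph (s i) (induced_on G (W i))) ?is))
      (token_graph k (induced_on G (\<Union>i\<in>{1..m}. W i)))"
    using embeds_cart_prods_token_graph[of ?is W s G] assms(5) disj fin
    unfolding set_is sum by auto
  moreover have "embeds id (token_graph k (induced_on G (\<Union>i\<in>{1..m}. W i))) (token_graph k G)"
    using H(2) by (intro embeds_token_graph_induced_on UN_least)
  ultimately have "embeds (id \<circ> f) (cart_prods (map T ?is)) (token_graph k G)"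
    by (metis embeds_comp)
  moreover have "pair_graph (H i)" if "i \<in> {1..m}" for i
    using fin[OF that] pair_graphD[OF assms(1)]
    unfolding H(1)[OF that] by (intro pair_graphI) auto
  then have "pair_graph (cart_prods (map T ?is))"
    unfolding T_def by (intro pair_graph_cart_prods) (auto intro: pair_graph_token_graph)
  moreover have "pair_graph (token_graph k G)"
    using assms(1) by (rule pair_graph_token_graph)
  ultimately show ?thesis
    unfolding T_def by (rule embeds_imp_iso_induced_subgraph)
qed

end
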